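(* Let a real number $r>1$ be given (fixed). Then the graph functions $B_{r,q}$ and $U$ are equivalent.
   Context: Graphs are finite and may have multiple edges and loops. For a graph $G=(V,E)$ and $A\subseteq E$, $\mathcal{C}(A)$ denotes the set of connected components of the spanning subgraph $(V,A)$, $k(A)=|\mathcal{C}(A)|$, and $|C|$ denotes the number of vertices of $C\in\mathcal{C}(A)$. For $k\in\mathbb{N}$ (a non-negative integer), $q$ ranging over the non-negative integers, and $x$ real, the $(r,q)$-dichromatic function is $$B_{r,q}(G;x,k):=\sum_{A\subseteq E}x^{|A|}\prod_{C\in\mathcal{C}(A)}\sum_{i=0}^{k-1}r^{|C|q^i}$$ (with $0^0=1$). Here $r$ is fixed and $B_{r,q}(G;x,k)$ is regarded as a function of $q,x,k$. The $U$-polynomial is $$U(G;z,x_1,x_2,\dots):=\sum_{A\subseteq E}x(\tau_A)(z-1)^{|A|-|V|+k(A)},$$ where $\tau_A=(n_1\ge n_2\ge\dots\ge n_l)$ is the partition of $|V|$ given by the numbers of vertices of the connected components of $(V,A)$, and $x(\tau_A)=x_{n_1}x_{n_2}\cdots x_{n_l}$. A graph function $P=(P(G);\,G\text{ graph})$ determines a graph function $Q=(Q(G);\,G\text{ graph})$ if, for every $G$, any evaluation of $Q(G)$ can be obtained given an oracle which returns evaluations of $P(G)$, where the graph $G$ itself is not known when computing evaluations of $Q(G)$; in case $Q(G)$ is a polynomial, this means that the evaluations of $P(G)$ determine the coefficients of $Q(G)$. That is, for all graphs $G,G'$, if $P(G)$ and $P(G')$ agree as functions of their arguments, then $Q(G)$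 and $Q(G')$ agree. $P$ and $Q$ are equivalent if each determines the other. *)

theory Defs
  imports Complex_Main "HOL-Library.Uprod" "HOL-Library.Multiset" "HOL-Library.Poly_Mapping"
begin

text \<open>
  Edges are abstract objects with an unordered pair of end vertices. Distinct edges may have the
  same ends, and \<open>Upair v v\<close> is a loop.
\<close>

record ('v, 'e) multigraph =
  vertices :: "'v set"
  edges :: "'e set"
  ends :: "'e \<Rightarrow> 'v uprod"

definition is_graph :: "('v, 'e) multigraph \<Rightarrow> bool" where
  "is_graph G \<longleftrightarrow>
     finite (vertices G) \<and> finite (edges G) \<and> (\<forall>e\<in>edges G. set_uprod (ends G e) \<subseteq> vertices G)"

definition adjacency :: "('v, 'e) multigraph \<Rightarrow> 'e set \<Rightarrow> ('v \<times> 'v) set" where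
  "adjacency G A = {(u, v). \<exists>e\<in>A. ends G e = Upair u v}"

text \<open>
  A connected component of the spanning subgraph with edge set \<open>A\<close> is represented by its vertex set.
\<close>

definition components :: "('v, 'e) multigraph \<Rightarrow> 'e set \<Rightarrow> 'v set set" where
  "components G A =
     vertices G // {(u, v). u \<in> vertices G \<and> v \<in> vertices G \<and> (u, v) \<in> (adjacency G A)\<^sup>*}"

definition dichromatic ::
  "real \<Rightarrow> ('v, 'e) multigraph \<Rightarrow> nat \<Rightarrow> real \<Rightarrow> nat \<Rightarrow> real" where
  "dichromatic r G q x k =
     (\<Sum>A\<in>Pow (edges G). x ^ card A * (\<Prod>C\<in>components G A. \<Sum>i<k. r ^ (card C * q ^ i)))"

text \<open>
  The polynomial ring over the reals in countably many indeterminates, as the monoid algebra of the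
  finitely supported exponent vectors. The indeterminates are \<open>z\<close>, with index 0, and
  \<open>x\<^sub>n\<close>, with index \<open>n \<ge> 1\<close>; components are nonempty, so \<open>indet 0\<close> never occurs as an \<open>x\<^sub>n\<close>.
\<close>

type_synonym polynomial = "(nat \<Rightarrow>\<^sub>0 nat) \<Rightarrow>\<^sub>0 real"

definition indet :: "nat \<Rightarrow> polynomial" where
  "indet n = Poly_Mapping.single (Poly_Mapping.single n 1) 1"

abbreviation z_indet :: polynomial where
  "z_indet \<equiv> indet 0"

text \<open>Integer partitions are represented as multisets of their parts.\<close>

definition component_partition :: "('v, 'e) multigraph \<Rightarrow> 'e set \<Rightarrow> nat multiset" where
  "component_partition G A = image_mset card (mset_set (components G A))"

definition partition_monomial :: "nat multiset \<Rightarrow> polynomial" where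
  "partition_monomial \<tau> = (\<Prod>n\<in>#\<tau>. indet n)"

text \<open>
  The exponent is written so that the subtraction on natural numbers does not truncate: a spanning
  subgraph has at least \<open>card (vertices G) - card A\<close> components.
\<close>

definition U_polynomial :: "('v, 'e) multigraph \<Rightarrow> polynomial" where
  "U_polynomial G =
     (\<Sum>A\<in>Pow (edges G). partition_monomial (component_partition G A) *
        (z_indet - 1) ^ (card A + card (components G A) - card (vertices G)))"

definition determines ::
  "(('v, 'e) multigraph \<Rightarrow> 'p) \<Rightarrow> (('v, 'e) multigraph \<Rightarrow> 'q) \<Rightarrow> bool" where
  "determines P Q \<longleftrightarrow> (\<forall>G G'. is_graph G \<longrightarrow> is_graph G' \<longrightarrow> P G = P G' \<longrightarrow> Q G = Q G')"

definition equivalent ::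
  "(('v, 'e) multigraph \<Rightarrow> 'p) \<Rightarrow> (('v, 'e) multigraph \<Rightarrow> 'q) \<Rightarrow> bool" where
  "equivalent P Q \<longleftrightarrow> determines P Q \<and> determines Q P"

end

theory Submission
  imports Defs "HOL-Computational_Algebra.Polynomial"
begin

text \<open>
  A value of \<open>B\<^bsub>r,q\<^esub>\<close> at \<open>x \<noteq> 0\<close> is \<open>x\<close> to the power \<open>|V|\<close> times the value of \<open>U\<close> at \<open>z = x + 1\<close>,
  \<open>x\<^sub>n = (\<Sum>i<k. r ^ (n * q ^ i)) / x\<close>, and \<open>U\<close> gives \<open>|V|\<close> through \<open>x\<^sub>n = t ^ n\<close>, \<open>z = 2\<close>.
  Conversely, the coefficient of \<open>x ^ a\<close> in \<open>B\<^bsub>r,q\<^esub>\<close> is the sum, over the partitions \<open>\<tau>\<^sub>A\<close> with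
  \<open>|A| = a\<close>, of the products over the parts \<open>n\<close> of the power sums \<open>\<Sum>i<k. y\<^sub>i ^ n\<close> at
  \<open>y\<^sub>i = r ^ (q ^ i)\<close>. As \<open>q\<close> tends to infinity, distinct monomials of degree \<open>|V|\<close> in the \<open>y\<^sub>i\<close> grow at
  different rates, so the values for all \<open>q\<close> determine this symmetric polynomial. For \<open>k \<ge> |V|\<close>
  such products of power sums are linearly independent, so the multiset of the \<open>\<tau>\<^sub>A\<close> is determined for every \<open>a\<close>.
\<close>

section \<open>Connected components\<close>

definition component_of :: "('v, 'e) multigraph \<Rightarrow> 'e set \<Rightarrow> 'v \<Rightarrow> 'v set" where
  "component_of G A v = {w \<in> vertices G. (v, w) \<in> (adjacency G A)\<^sup>*}"

lemma sym_reachable: "sym ((adjacency G A)\<^sup>*)"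
proof (rule sym_rtrancl)
  show "sym (adjacency G A)"
    unfolding sym_def adjacency_def by (auto; metis Upair_inject)
qed

lemma reachable_commute: "(u, v) \<in> (adjacency G A)\<^sup>* \<longleftrightarrow> (v, u) \<in> (adjacency G A)\<^sup>*"
  using sym_reachable by (metis symD)

lemma component_relation_equiv:
  "equiv (vertices G) {(u, v). u \<in> vertices G \<and> v \<in> vertices G \<and> (u, v) \<in> (adjacency G A)\<^sup>*}"
  by (rule equivI)
     (auto simp: refl_on_def sym_def trans_def reachable_commute intro: rtrancl_trans)

lemma components_conv_image: "components G A = component_of G A ` vertices G"
  by (auto simp: components_def quotient_def component_of_def)

lemma finite_components [simp]: "is_graph G \<Longrightarrow> finite (components G A)"
  by (simp add: components_conv_image is_graph_def)

lemma card_components_le: "is_graph G \<Longrightarrow> card (components G A) \<le> card (vertices G)"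
  by (simp add: components_conv_image is_graph_def card_image_le)

lemma sum_card_components:
  assumes "is_graph G"
  shows "(\<Sum>C\<in>components G A. card C) = card (vertices G)"
proof -
  have fin: "finite (vertices G)" using assms by (simp add: is_graph_def)
  have "card (\<Union>(components G A)) = (\<Sum>C\<in>components G A. card C)"
  proof (rule card_Union_disjoint)
    show "pairwise disjnt (components G A)"
      unfolding pairwise_def disjnt_def components_def
      using quotient_disj[OF component_relation_equiv] by blast
    show "finite C" if "C \<in> components G A" for C
      using that fin by (auto simp: components_conv_image component_of_def)
  qed
  moreover have "\<Union>(components G A) = vertices G"
    unfolding components_def by (rule Union_quotient[OF component_relation_equiv])
  ultimately show ?thesis by simp
qed

lemma card_component_pos:
  assumes "is_graph G" "C \<in> components G A"
  shows "card C > 0"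
proof -
  have "finite C" "C \<noteq> {}"
    using assms by (auto simp: components_conv_image component_of_def is_graph_def)
  then show ?thesis by (simp add: card_gt_0_iff)
qed

text \<open>A path from \<open>w\<close> could use the new edge for the first time only from
  \<open>u\<close> or \<open>v\<close>, reached by old edges, which is excluded. Hence components
  that contain neither end of a new edge are unchanged.\<close>

lemma reachable_insert_edge:
  assumes e: "ends G e = Upair u v"
    and "(w, u) \<notin> (adjacency G A)\<^sup>*" "(w, v) \<notin> (adjacency G A)\<^sup>*"
  shows "(w, y) \<in> (adjacency G (insert e A))\<^sup>* \<longleftrightarrow> (w, y) \<in> (adjacency G A)\<^sup>*"
proof
  assume "(w, y) \<in> (adjacency G (insert e A))\<^sup>*"
  then show "(w, y) \<in> (adjacency G A)\<^sup>*"
  proof (induction rule: rtrancl_induct)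
    case (step a b)
    then have "a \<noteq> u" "a \<noteq> v" using assms(2,3) by auto
    then have "(a, b) \<in> adjacency G A"
      using step.hyps(2) e by (auto simp: adjacency_def)
    with step.IH show ?case by (rule rtrancl_into_rtrancl)
  qed simp
next
  assume "(w, y) \<in> (adjacency G A)\<^sup>*"
  moreover have "adjacency G A \<subseteq> adjacency G (insert e A)" by (auto simp: adjacency_def)
  ultimately show "(w, y) \<in> (adjacency G (insert e A))\<^sup>*"
    using rtrancl_mono by blast
qed

text \<open>One new edge lowers the number of components by at most one. The bound keeps the
  exponent of \<open>z_indet - 1\<close> from truncating.\<close>

lemma card_vertices_le:
  assumes G: "is_graph G" and "finite A" "A \<subseteq> edges G"
  shows "card (vertices G) \<le> card A + card (components G A)"
  using assms(2,3)
proof (induction A rule: finite_induct)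
  case empty
  have "components G {} = (\<lambda>v. {v}) ` vertices G"
    by (auto simp: components_conv_image component_of_def adjacency_def image_def)
  then have "card (components G {}) = card (vertices G)"
    by (simp add: card_image inj_on_def)
  then show ?case by simp
next
  case (insert e A)
  obtain u v where e: "ends G e = Upair u v" by (cases "ends G e")
  have uv: "u \<in> vertices G" "v \<in> vertices G"
    using G insert.prems e by (force simp: is_graph_def)+
  let ?c = "component_of G A" and ?c' = "component_of G (insert e A)"
  let ?K = "components G A" and ?K' = "components G (insert e A)"
  \<comment> \<open>Components other than those of \<open>u\<close> and \<open>v\<close> survive,
    and none of them is the new component of \<open>u\<close>. This compares
    \<open>card ?K - 2\<close> with \<open>card ?K' - 1\<close>.\<close>
  have "?K - {?c u, ?c v} \<subseteq> ?K' - {?c' u}"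
  proof
    fix C assume C: "C \<in> ?K - {?c u, ?c v}"
    then obtain w where w: "w \<in> vertices G" "C = ?c w" by (auto simp: components_conv_image)
    have nr: "(w, y) \<notin> (adjacency G A)\<^sup>*" if "?c w \<noteq> ?c y" for y
      using that reachable_commute[of w y] unfolding component_of_def
      by (blast intro: rtrancl_trans)
    have wu: "(w, u) \<notin> (adjacency G A)\<^sup>*" and wv: "(w, v) \<notin> (adjacency G A)\<^sup>*"
      using C w nr by auto
    have "?c' w = ?c w"
      unfolding component_of_def using reachable_insert_edge[OF e wu wv] by auto
    moreover have "u \<in> ?c' u" using uv by (simp add: component_of_def)
    moreover have "u \<notin> ?c w" using wu by (simp add: component_of_def)
    ultimately show "C \<in> ?K' - {?c' u}" using w by (auto simp: components_conv_image)
  qed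
  then have "card (?K - {?c u, ?c v}) \<le> card (?K' - {?c' u})"
    using G by (intro card_mono) auto
  moreover have "card ?K - card {?c u, ?c v} \<le> card (?K - {?c u, ?c v})"
    by (rule diff_card_le_card_Diff) simp
  moreover have "card {?c u, ?c v} \<le> 2"
    by (simp add: card_insert_if)
  moreover have "?c' u \<in> ?K'" using uv by (simp add: components_conv_image)
  then have "card (?K' - {?c' u}) = card ?K' - 1" "card ?K' > 0"
    using G by (auto simp: card_gt_0_iff)
  ultimately have "card ?K \<le> card ?K' + 1" by linarith
  then show ?case using insert by simp
qed

lemma size_component_partition: "size (component_partition G A) = card (components G A)"
  by (simp add: component_partition_def)

lemma sum_component_partition:
  "is_graph G \<Longrightarrow> sum_mset (component_partition G A) = card (vertices G)"
  by (simp add: component_partition_def flip: sum_unfold_sum_mset add: sum_card_components)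

lemma zero_notin_component_partition: "is_graph G \<Longrightarrow> 0 \<notin># component_partition G A"
  using card_component_pos by (fastforce simp: component_partition_def)

section \<open>Evaluation of polynomials\<close>

lemma poly_mapping_sum_single:
  "p = (\<Sum>m\<in>Poly_Mapping.keys p. Poly_Mapping.single m (Poly_Mapping.lookup p m))"
  by (rule poly_mapping_eqI)
     (simp add: lookup_sum lookup_single when_def in_keys_iff)

text \<open>Terms with the same exponent stay uncollected, so that evaluation and sign arguments
  work term by term.\<close>

lemma poly_mapping_mult_conv_sum:
  fixes p q :: "'a::monoid_add \<Rightarrow>\<^sub>0 'b::semiring_1"
  shows "p * q = (\<Sum>m\<in>Poly_Mapping.keys p. \<Sum>m'\<in>Poly_Mapping.keys q.
    Poly_Mapping.single (m + m') (Poly_Mapping.lookup p m * Poly_Mapping.lookup q m'))"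
  by (subst poly_mapping_sum_single[of p], subst poly_mapping_sum_single[of q])
     (simp add: sum_product mult_single)

definition monomial_value :: "(nat \<Rightarrow> real) \<Rightarrow> (nat \<Rightarrow>\<^sub>0 nat) \<Rightarrow> real" where
  "monomial_value y m = (\<Prod>i\<in>Poly_Mapping.keys m. y i ^ Poly_Mapping.lookup m i)"

lemma monomial_value_superset:
  "finite S \<Longrightarrow> Poly_Mapping.keys m \<subseteq> S \<Longrightarrow>
    monomial_value y m = (\<Prod>i\<in>S. y i ^ Poly_Mapping.lookup m i)"
  unfolding monomial_value_def by (rule prod.mono_neutral_left) (auto simp: in_keys_iff)

lemma monomial_value_zero [simp]: "monomial_value y 0 = 1"
  by (simp add: monomial_value_def)

lemma monomial_value_single [simp]: "monomial_value y (Poly_Mapping.single i n) = y i ^ n"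
  by (simp add: monomial_value_def)

lemma monomial_value_add: "monomial_value y (m + m') = monomial_value y m * monomial_value y m'"
proof -
  let ?S = "Poly_Mapping.keys m \<union> Poly_Mapping.keys m'"
  have "Poly_Mapping.keys (m + m') \<subseteq> ?S" by (rule Poly_Mapping.keys_add)
  then show ?thesis
    by (simp add: monomial_value_superset[of ?S] lookup_add power_add prod.distrib)
qed

definition poly_value :: "(nat \<Rightarrow> real) \<Rightarrow> polynomial \<Rightarrow> real" where
  "poly_value y p = (\<Sum>m\<in>Poly_Mapping.keys p. Poly_Mapping.lookup p m * monomial_value y m)"

lemma poly_value_superset:
  "finite S \<Longrightarrow> Poly_Mapping.keys p \<subseteq> S \<Longrightarrow>
    poly_value y p = (\<Sum>m\<in>S. Poly_Mapping.lookup p m * monomial_value y m)"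
  unfolding poly_value_def by (rule sum.mono_neutral_left) (auto simp: in_keys_iff)

lemma poly_value_zero [simp]: "poly_value y 0 = 0"
  by (simp add: poly_value_def)

lemma poly_value_single [simp]: "poly_value y (Poly_Mapping.single m a) = a * monomial_value y m"
  by (simp add: poly_value_def)

lemma poly_value_one [simp]: "poly_value y 1 = 1"
  by (simp add: poly_value_def lookup_one)

lemma poly_value_indet [simp]: "poly_value y (indet n) = y n"
  by (simp add: indet_def)

lemma poly_value_add: "poly_value y (p + q) = poly_value y p + poly_value y q"
proof -
  let ?S = "Poly_Mapping.keys p \<union> Poly_Mapping.keys q"
  have "Poly_Mapping.keys (p + q) \<subseteq> ?S" by (rule Poly_Mapping.keys_add)
  then show ?thesis
    by (simp add: poly_value_superset[of ?S] lookup_add distrib_right sum.distrib)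
qed

lemma poly_value_diff: "poly_value y (p - q) = poly_value y p - poly_value y q"
  using poly_value_add[of y "p - q" q] by simp

lemma poly_value_sum: "poly_value y (\<Sum>a\<in>A. f a) = (\<Sum>a\<in>A. poly_value y (f a))"
  by (induction A rule: infinite_finite_induct) (simp_all add: poly_value_add)

lemma poly_value_mult: "poly_value y (p * q) = poly_value y p * poly_value y q"
  by (subst poly_mapping_mult_conv_sum)
     (simp add: poly_value_sum monomial_value_add, simp add: poly_value_def sum_product mult_ac)

lemma poly_value_power: "poly_value y (p ^ n) = poly_value y p ^ n"
  by (induction n) (simp_all add: poly_value_mult)

lemma poly_value_prod_mset: "poly_value y (\<Prod>n\<in>#\<tau>. f n) = (\<Prod>n\<in>#\<tau>. poly_value y (f n))"
  by (induction \<tau>) (simp_all add: poly_value_mult)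

lemma poly_value_U_polynomial:
  "poly_value y (U_polynomial G) =
    (\<Sum>A\<in>Pow (edges G). (\<Prod>n\<in>#component_partition G A. y n) *
      (y 0 - 1) ^ (card A + card (components G A) - card (vertices G)))"
  by (simp add: U_polynomial_def partition_monomial_def poly_value_sum poly_value_mult
      poly_value_prod_mset poly_value_power poly_value_diff)

section \<open>Products of power sums\<close>

text \<open>The polynomial type is reused for the variables \<open>y_i\<close> with
  \<open>i < k\<close>; index \<open>0\<close> is now an ordinary variable instead of
  \<open>z\<close>. For \<open>n = 0\<close> this is the constant \<open>k\<close>.\<close>

definition power_sum :: "nat \<Rightarrow> nat \<Rightarrow> polynomial" where
  "power_sum k n = (\<Sum>i<k. Poly_Mapping.single (Poly_Mapping.single i n) 1)"

definition power_sum_product :: "nat \<Rightarrow> nat multiset \<Rightarrow> polynomial" where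
  "power_sum_product k \<tau> = (\<Prod>n\<in>#\<tau>. power_sum k n)"

lemma power_sum_product_empty [simp]: "power_sum_product k {#} = 1"
  by (simp add: power_sum_product_def)

lemma power_sum_product_add_mset [simp]:
  "power_sum_product k (add_mset n \<tau>) = power_sum k n * power_sum_product k \<tau>"
  by (simp add: power_sum_product_def)

lemma poly_value_power_sum_product:
  "poly_value y (power_sum_product k \<tau>) = (\<Prod>n\<in>#\<tau>. \<Sum>i<k. y i ^ n)"
  by (simp add: power_sum_product_def power_sum_def poly_value_prod_mset poly_value_sum)

section \<open>Polynomials with nonnegative coefficients\<close>

text \<open>Nonnegativity rules out cancellation: no monomial is lost in a sum or a product.\<close>

definition nonneg_coeffs :: "('a \<Rightarrow>\<^sub>0 real) \<Rightarrow> bool" where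
  "nonneg_coeffs p \<longleftrightarrow> (\<forall>m. Poly_Mapping.lookup p m \<ge> 0)"

lemma nonneg_coeffs_mult:
  fixes p q :: "'a::monoid_add \<Rightarrow>\<^sub>0 real"
  assumes "nonneg_coeffs p" "nonneg_coeffs q"
  shows "nonneg_coeffs (p * q)"
  using assms unfolding nonneg_coeffs_def
  by (subst poly_mapping_mult_conv_sum)
     (auto simp: lookup_sum lookup_single when_def intro!: sum_nonneg)

lemma keys_add_nonneg_coeffs:
  assumes "nonneg_coeffs p" "nonneg_coeffs q"
  shows "Poly_Mapping.keys (p + q) = Poly_Mapping.keys p \<union> Poly_Mapping.keys q"
  using assms by (auto simp: nonneg_coeffs_def in_keys_iff lookup_add add_nonneg_eq_0_iff)

text \<open>The coefficient at \<open>m + m'\<close> is a sum of nonnegative terms, and the term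
  from \<open>m\<close> and \<open>m'\<close> is positive. This complements
  \<open>keys_mult\<close>, which bounds the keys only from above.\<close>

lemma add_in_keys_mult_nonneg_coeffs:
  fixes p q :: "'a::monoid_add \<Rightarrow>\<^sub>0 real"
  assumes p: "nonneg_coeffs p" and q: "nonneg_coeffs q"
    and m: "m \<in> Poly_Mapping.keys p" and m': "m' \<in> Poly_Mapping.keys q"
  shows "m + m' \<in> Poly_Mapping.keys (p * q)"
proof -
  let ?f = "\<lambda>a b. Poly_Mapping.lookup
    (Poly_Mapping.single (a + b) (Poly_Mapping.lookup p a * Poly_Mapping.lookup q b)) (m + m')"
  have nonneg: "?f a b \<ge> 0" for a b
    using p q by (simp add: nonneg_coeffs_def lookup_single when_def)
  have "0 < ?f m m'"
    using p q m m' by (simp add: nonneg_coeffs_def in_keys_iff less_le)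
  also have "\<dots> \<le> (\<Sum>b\<in>Poly_Mapping.keys q. ?f m b)"
    using m' nonneg by (intro member_le_sum) auto
  also have "\<dots> \<le> (\<Sum>a\<in>Poly_Mapping.keys p. \<Sum>b\<in>Poly_Mapping.keys q. ?f a b)"
    using m nonneg
    by (intro member_le_sum[where f = "\<lambda>a. \<Sum>b\<in>Poly_Mapping.keys q. ?f a b"])
       (auto intro: sum_nonneg)
  also have "\<dots> = Poly_Mapping.lookup (p * q) (m + m')"
    by (simp only: poly_mapping_mult_conv_sum[of p q] lookup_sum)
  finally show ?thesis by (simp add: in_keys_iff)
qed

lemma nonneg_coeffs_power_sum: "nonneg_coeffs (power_sum k n)"
  unfolding nonneg_coeffs_def power_sum_def
  by (auto simp: lookup_sum lookup_single when_def intro!: sum_nonneg)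

lemma nonneg_coeffs_power_sum_product: "nonneg_coeffs (power_sum_product k \<tau>)"
proof (induction \<tau>)
  case empty
  then show ?case by (simp add: nonneg_coeffs_def lookup_one when_def)
qed (simp add: nonneg_coeffs_mult nonneg_coeffs_power_sum)

lemma keys_power_sum: "Poly_Mapping.keys (power_sum k n) = (\<lambda>i. Poly_Mapping.single i n) ` {..<k}"
  unfolding power_sum_def
proof (induction k)
  case (Suc k)
  have "Poly_Mapping.keys (power_sum k n + Poly_Mapping.single (Poly_Mapping.single k n) 1) =
    Poly_Mapping.keys (power_sum k n) \<union> {Poly_Mapping.single k n}"
    using nonneg_coeffs_power_sum
    by (subst keys_add_nonneg_coeffs) (auto simp: nonneg_coeffs_def lookup_single when_def)
  with Suc show ?case by (simp add: power_sum_def lessThan_Suc add.commute)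
qed simp

lemma keys_power_sum_product_add_msetE:
  assumes "m \<in> Poly_Mapping.keys (power_sum_product k (add_mset n \<tau>))"
  obtains i m' where "m' \<in> Poly_Mapping.keys (power_sum_product k \<tau>)"
    "m = Poly_Mapping.single i n + m'"
  using assms keys_mult[of "power_sum k n" "power_sum_product k \<tau>"]
  by (auto simp: keys_power_sum)

lemma keys_add_nat:
  fixes m m' :: "'a \<Rightarrow>\<^sub>0 nat"
  shows "Poly_Mapping.keys (m + m') = Poly_Mapping.keys m \<union> Poly_Mapping.keys m'"
  by (auto simp: in_keys_iff lookup_add)

section \<open>Exponents of the monomials in a product of power sums\<close>

definition exponents :: "(nat \<Rightarrow>\<^sub>0 nat) \<Rightarrow> nat multiset" where
  "exponents m = image_mset (Poly_Mapping.lookup m) (mset_set (Poly_Mapping.keys m))"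

text \<open>A monomial of the product arises by sending each part to a variable. Parts sent to the
  same variable merge and zero parts vanish, so the number of variables drops unless positive parts
  go to distinct variables; then the exponents are the parts.\<close>

lemma size_exponents_power_sum_product:
  assumes "m \<in> Poly_Mapping.keys (power_sum_product k \<tau>)"
  shows "size (exponents m) \<le> size \<tau> \<and> (size (exponents m) = size \<tau> \<longrightarrow> exponents m = \<tau>)"
  using assms
proof (induction \<tau> arbitrary: m)
  case empty
  then show ?case by (simp add: exponents_def)
next
  case (add n \<tau>)
  from add.prems obtain i m' where m': "m' \<in> Poly_Mapping.keys (power_sum_product k \<tau>)"
    "m = Poly_Mapping.single i n + m'" by (rule keys_power_sum_product_add_msetE)
  note IH = add.IH[OF m'(1)]
  show ?case
  \<comment> \<open>In the first case the partition gains a part but the monomial gains no variable,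
    so the inequality becomes strict.\<close>
  proof (cases "n = 0 \<or> i \<in> Poly_Mapping.keys m'")
    case True
    then have "Poly_Mapping.keys m = Poly_Mapping.keys m'"
      using m'(2) by (auto simp: keys_add_nat split: if_splits)
    then have "size (exponents m) = size (exponents m')" by (simp add: exponents_def)
    then show ?thesis using IH by simp
  next
    case False
    then have "Poly_Mapping.keys m = insert i (Poly_Mapping.keys m')"
      using m'(2) by (auto simp: keys_add_nat)
    moreover have "Poly_Mapping.lookup m i = n"
      using m'(2) False by (simp add: lookup_add in_keys_iff)
    moreover have "Poly_Mapping.lookup m j = Poly_Mapping.lookup m' j"
      if "j \<in> Poly_Mapping.keys m'" for j
      using m'(2) False that by (auto simp: lookup_add lookup_single when_def)
    ultimately have "exponents m = add_mset n (exponents m')"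
      using False by (auto simp: exponents_def intro!: image_mset_cong)
    then show ?thesis using IH by simp
  qed
qed

text \<open>Sending the parts to distinct variables gives such a monomial, since positive parts make
  each chosen variable occur.\<close>

lemma power_sum_product_key_exists:
  assumes "0 \<notin># \<tau>" "size \<tau> \<le> k"
  shows "\<exists>m\<in>Poly_Mapping.keys (power_sum_product k \<tau>). Poly_Mapping.keys m = {..<size \<tau>}"
  using assms
proof (induction \<tau>)
  case empty
  then show ?case by simp
next
  case (add n \<tau>)
  then obtain m where m: "m \<in> Poly_Mapping.keys (power_sum_product k \<tau>)"
    "Poly_Mapping.keys m = {..<size \<tau>}" by auto
  \<comment> \<open>The index \<open>size \<tau>\<close> is the first one that does not occur in
    \<open>m\<close>, and it is below \<open>k\<close>.\<close>
  have "Poly_Mapping.single (size \<tau>) n + m \<in> Poly_Mapping.keys (power_sum_product k (add_mset n \<tau>))"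
    using m(1) add.prems
    by (auto intro!: add_in_keys_mult_nonneg_coeffs simp: nonneg_coeffs_power_sum
        nonneg_coeffs_power_sum_product keys_power_sum)
  moreover have "Poly_Mapping.keys (Poly_Mapping.single (size \<tau>) n + m) = {..<size (add_mset n \<tau>)}"
    using add.prems(1) by (simp add: keys_add_nat m(2) lessThan_Suc)
  ultimately show ?case by blast
qed

lemma nonneg_coeffs_sum_mset:
  "(\<And>\<tau>. nonneg_coeffs (f \<tau>)) \<Longrightarrow> nonneg_coeffs (\<Sum>\<tau>\<in>#M. f \<tau>)"
  by (induction M) (auto simp: nonneg_coeffs_def lookup_add)

lemma keys_sum_mset_nonneg_coeffs:
  "(\<And>\<tau>. nonneg_coeffs (f \<tau>)) \<Longrightarrow>
    Poly_Mapping.keys (\<Sum>\<tau>\<in>#M. f \<tau>) = (\<Union>\<tau>\<in>set_mset M. Poly_Mapping.keys (f \<tau>))"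
  by (induction M) (auto simp: keys_add_nonneg_coeffs nonneg_coeffs_sum_mset)

text \<open>
  A partition \<open>\<tau>\<close> of maximal length contributes a monomial with \<open>size \<tau>\<close> variables whose exponents
  are the parts of \<open>\<tau>\<close>, and among partitions of at most this length only \<open>\<tau>\<close> does.
\<close>

lemma sum_power_sum_product_inject:
  assumes "\<forall>\<tau>\<in>#M + M'. 0 \<notin># \<tau> \<and> size \<tau> \<le> k"
    and "(\<Sum>\<tau>\<in>#M. power_sum_product k \<tau>) = (\<Sum>\<tau>\<in>#M'. power_sum_product k \<tau>)"
  shows "M = M'"
  using assms
proof (induction "size M" arbitrary: M M' rule: less_induct)
  case less
  show ?case
  proof (cases "M + M' = {#}")
    case False
    then have ne: "set_mset (M + M') \<noteq> {}" by (metis set_mset_eq_empty_iff)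
    have "Max (size ` set_mset (M + M')) \<in> size ` set_mset (M + M')"
      using ne by (intro Max_in) auto
    then obtain \<tau> where \<tau>: "Max (size ` set_mset (M + M')) = size \<tau>" "\<tau> \<in># M + M'"
      by (rule imageE)
    have max: "size \<sigma> \<le> size \<tau>" if "\<sigma> \<in># M + M'" for \<sigma>
      unfolding \<tau>(1)[symmetric] using that by (intro Max_ge) auto
    obtain m where m: "m \<in> Poly_Mapping.keys (power_sum_product k \<tau>)"
      "Poly_Mapping.keys m = {..<size \<tau>}"
      using power_sum_product_key_exists[of \<tau> k] \<tau>(2) less.prems(1) by blast
    have size_m: "size (exponents m) = size \<tau>" by (simp add: exponents_def m(2))
    have unique: "\<sigma> = \<tau>"
      if "\<sigma> \<in># M + M'" "m \<in> Poly_Mapping.keys (power_sum_product k \<sigma>)" for \<sigma>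
      by (metis that le_antisym max size_m size_exponents_power_sum_product m(1))
    note keys = keys_sum_mset_nonneg_coeffs[of "power_sum_product k", OF nonneg_coeffs_power_sum_product]
    have "m \<in> Poly_Mapping.keys (\<Sum>\<tau>\<in>#M. power_sum_product k \<tau>) \<or>
      m \<in> Poly_Mapping.keys (\<Sum>\<tau>\<in>#M'. power_sum_product k \<tau>)"
      unfolding keys using m(1) \<tau>(2) by auto
    \<comment> \<open>Equal sums have equal keys, so \<open>m\<close> occurs on both sides. By
      uniqueness both multisets contain \<open>\<tau>\<close>, and one copy can be removed from
      each.\<close>
    then have "m \<in> Poly_Mapping.keys (\<Sum>\<tau>\<in>#M. power_sum_product k \<tau>)"
      "m \<in> Poly_Mapping.keys (\<Sum>\<tau>\<in>#M'. power_sum_product k \<tau>)"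
      unfolding less.prems(2) by blast+
    then obtain \<sigma> \<sigma>' where "\<sigma> \<in># M" "m \<in> Poly_Mapping.keys (power_sum_product k \<sigma>)"
      "\<sigma>' \<in># M'" "m \<in> Poly_Mapping.keys (power_sum_product k \<sigma>')"
      unfolding keys by blast
    then have "\<tau> \<in># M" "\<tau> \<in># M'" using unique by auto
    then obtain N N' where N: "M = add_mset \<tau> N" "M' = add_mset \<tau> N'"
      by (meson multi_member_split)
    have "N = N'"
      by (rule less.hyps) (use less.prems N in auto)
    with N show ?thesis by simp
  qed simp
qed

section \<open>Letting \<open>q\<close> tend to infinity\<close>

text \<open>The exponent of \<open>r\<close> in the value of a monomial at
  \<open>y_i = r ^ (q ^ i)\<close>, as a polynomial in \<open>q\<close>. Growth in \<open>q\<close>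
  is then compared by the order on \<open>real poly\<close>, and the value at \<open>1\<close> is
  the total degree.\<close>

definition exponent_poly :: "(nat \<Rightarrow>\<^sub>0 nat) \<Rightarrow> real poly" where
  "exponent_poly m = (\<Sum>i\<in>Poly_Mapping.keys m. monom (real (Poly_Mapping.lookup m i)) i)"

lemma coeff_exponent_poly [simp]: "coeff (exponent_poly m) i = real (Poly_Mapping.lookup m i)"
  by (auto simp: exponent_poly_def coeff_sum in_keys_iff)

lemma exponent_poly_inject [simp]: "exponent_poly m = exponent_poly m' \<longleftrightarrow> m = m'"
  by (metis coeff_exponent_poly of_nat_eq_iff poly_mapping_eqI)

lemma exponent_poly_zero [simp]: "exponent_poly 0 = 0"
  by (simp add: exponent_poly_def)

lemma exponent_poly_single_add:
  "exponent_poly (Poly_Mapping.single i n + m) = monom (real n) i + exponent_poly m"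
  by (rule poly_eqI) (simp add: lookup_add lookup_single when_def)

lemma monomial_value_conv_powr:
  assumes "r > 0"
  shows "monomial_value (\<lambda>i. r ^ (q ^ i)) m = r powr poly (exponent_poly m) (real q)"
proof -
  have "monomial_value (\<lambda>i. r ^ (q ^ i)) m =
    (\<Prod>i\<in>Poly_Mapping.keys m. r powr (real (Poly_Mapping.lookup m i) * real q ^ i))"
    unfolding monomial_value_def
  proof (rule prod.cong)
    fix i
    have "(r ^ (q ^ i)) ^ Poly_Mapping.lookup m i = r ^ (Poly_Mapping.lookup m i * q ^ i)"
      by (simp add: mult.commute flip: power_mult)
    also have "\<dots> = r powr (real (Poly_Mapping.lookup m i) * real q ^ i)"
      using assms by (simp flip: powr_realpow)
    finally show "(r ^ (q ^ i)) ^ Poly_Mapping.lookup m i = \<dots>" .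
  qed simp
  also have "\<dots> = r powr poly (exponent_poly m) (real q)"
    using assms by (simp add: exponent_poly_def poly_sum poly_monom powr_sum)
  finally show ?thesis .
qed

text \<open>Homogeneity: every monomial of \<open>power_sum k n\<close> has total degree
  \<open>n\<close>, and total degrees add under multiplication.\<close>

lemma exponent_poly_power_sum_product:
  assumes "m \<in> Poly_Mapping.keys (power_sum_product k \<tau>)"
  shows "poly (exponent_poly m) 1 = real (sum_mset \<tau>)"
  using assms
proof (induction \<tau> arbitrary: m)
  case (add n \<tau>)
  from add.prems obtain i m' where "m' \<in> Poly_Mapping.keys (power_sum_product k \<tau>)"
    "m = Poly_Mapping.single i n + m'" by (rule keys_power_sum_product_add_msetE)
  then show ?case using add.IH by (simp add: exponent_poly_single_add poly_monom)
qed simp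

lemma powr_poly_tendsto_0:
  fixes p :: "real poly"
  assumes "r > 1" "p > 0" "degree p > 0"
  shows "(\<lambda>q::nat. r powr (- poly p (real q))) \<longlonglongrightarrow> 0"
proof -
  \<comment> \<open>The order on polynomials is decided by the sign of the leading
    coefficient.\<close>
  have lc: "lead_coeff p > 0" using assms(2) by (simp add: less_poly_def pos_poly_def last_coeffs_eq_coeff_degree)
  \<comment> \<open>The filter \<open>at_infinity\<close> controls only the absolute value; eventual
    positivity then gives divergence to plus infinity.\<close>
  have "filterlim (poly p) at_infinity at_top"
    using filterlim_poly_at_infinity[OF assms(3)] at_top_le_at_infinity by (rule filterlim_mono[OF _ order_refl])
  moreover have "eventually (\<lambda>x. poly p x > 0) at_top"
    using poly_pinfty_gt_lc[OF lc] lc unfolding eventually_at_top_linorder by (meson less_le_trans)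
  ultimately have "filterlim (poly p) at_top at_top"
    by (rule filterlim_at_infinity_imp_filterlim_at_top)
  then have "filterlim (\<lambda>q::nat. poly p (real q)) at_top sequentially"
    by (rule filterlim_compose) (rule filterlim_real_sequentially)
  then have "filterlim (\<lambda>q::nat. - poly p (real q)) at_bot sequentially"
    by (simp add: filterlim_uminus_at_top)
  then have "filterlim (\<lambda>q::nat. ln r * (- poly p (real q))) at_bot sequentially"
    using assms(1) by (intro filterlim_tendsto_pos_mult_at_bot[OF tendsto_const]) auto
  then have "(\<lambda>q::nat. exp (ln r * (- poly p (real q)))) \<longlonglongrightarrow> 0"
    by (rule filterlim_compose[OF exp_at_bot])
  then show ?thesis using assms(1) by (simp add: powr_def mult.commute)
qed

text \<open>
  The variable with index \<open>0\<close> gets the value \<open>r\<close> for every \<open>q\<close>, so the values alone do not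
  distinguish its powers; prescribing the total degree \<open>c\<close> of the monomials makes up for this.
\<close>

lemma poly_value_powers_inject:
  assumes r: "r > 1"
    and hom: "\<forall>m\<in>Poly_Mapping.keys p \<union> Poly_Mapping.keys p'. poly (exponent_poly m) 1 = c"
    and eq: "\<And>q::nat. poly_value (\<lambda>i. r ^ (q ^ i)) p = poly_value (\<lambda>i. r ^ (q ^ i)) p'"
  shows "p = p'"
proof (rule ccontr)
  assume "p \<noteq> p'"
  define D where "D = p - p'"
  let ?K = "Poly_Mapping.keys D"
  have K: "?K \<noteq> {}"
  proof
    assume "?K = {}"
    then have "D = 0" using poly_mapping_sum_single[of D] by simp
    with \<open>p \<noteq> p'\<close> show False by (simp add: D_def)
  qed
  have hom': "poly (exponent_poly m) 1 = c" if "m \<in> ?K" for m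
    using that hom by (auto simp: D_def in_keys_iff lookup_minus)
  \<comment> \<open>The greatest exponent polynomial belongs to the dominant monomial
    \<open>m\<close>; \<open>?e q m'\<close> is the ratio of the value of \<open>m'\<close> to that
    of \<open>m\<close>.\<close>
  have "Max (exponent_poly ` ?K) \<in> exponent_poly ` ?K" using K by (intro Max_in) auto
  then obtain m where m: "m \<in> ?K" "exponent_poly m = Max (exponent_poly ` ?K)" by auto
  let ?e = "\<lambda>q m'. r powr (- poly (exponent_poly m - exponent_poly m') (real q))"
  have lim: "(\<lambda>q. Poly_Mapping.lookup D m' * ?e q m') \<longlonglongrightarrow> 0" if m': "m' \<in> ?K - {m}" for m'
  proof -
    have "exponent_poly m' \<le> exponent_poly m"
      unfolding m(2) using m' by (intro Max_ge) auto
    moreover have ne: "exponent_poly m' \<noteq> exponent_poly m" using m' by simp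
    ultimately have "exponent_poly m - exponent_poly m' > 0"
      by (metis diff_gt_0_iff_gt order_le_less)
    moreover have "degree (exponent_poly m - exponent_poly m') > 0"
    proof (rule ccontr)
      assume "\<not> ?thesis"
      then obtain a where a: "exponent_poly m - exponent_poly m' = [:a:]"
        by (metis degree_eq_zeroE neq0_conv)
      then have "poly (exponent_poly m - exponent_poly m') 1 = a" by simp
      then have "a = 0" using hom'[OF m(1)] hom'[of m'] m' by simp
      with a ne show False by simp
    qed
    ultimately have "(\<lambda>q. ?e q m') \<longlonglongrightarrow> 0" by (rule powr_poly_tendsto_0[OF r])
    then show ?thesis by (rule tendsto_mult_right_zero)
  qed
  \<comment> \<open>Dividing the vanishing value of \<open>D\<close> by the value of
    \<open>m\<close> isolates the coefficient of \<open>m\<close>, which the limit forces to be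
    \<open>0\<close>.\<close>
  have "(\<Sum>m'\<in>?K - {m}. Poly_Mapping.lookup D m' * ?e q m') = - Poly_Mapping.lookup D m" for q
  proof -
    have "0 = poly_value (\<lambda>i. r ^ (q ^ i)) D" using eq by (simp add: D_def poly_value_diff)
    also have "\<dots> = (\<Sum>m'\<in>?K. Poly_Mapping.lookup D m' * r powr poly (exponent_poly m') (real q))"
      using r by (simp add: poly_value_def monomial_value_conv_powr)
    also have "\<dots> = r powr poly (exponent_poly m) (real q) *
      (\<Sum>m'\<in>?K. Poly_Mapping.lookup D m' * ?e q m')"
      by (simp add: sum_distrib_left mult.left_commute flip: powr_add)
    finally have "0 = (\<Sum>m'\<in>?K. Poly_Mapping.lookup D m' * ?e q m')" using r by simp
    also have "\<dots> = Poly_Mapping.lookup D m + (\<Sum>m'\<in>?K - {m}. Poly_Mapping.lookup D m' * ?e q m')"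
      using m(1) r by (simp add: sum.remove)
    finally show ?thesis by simp
  qed
  moreover have "(\<lambda>q. \<Sum>m'\<in>?K - {m}. Poly_Mapping.lookup D m' * ?e q m') \<longlonglongrightarrow> 0"
    using lim by (rule tendsto_null_sum)
  ultimately have "(\<lambda>q::nat. - Poly_Mapping.lookup D m) \<longlonglongrightarrow> 0" by simp
  then have "Poly_Mapping.lookup D m = 0" by (simp add: LIMSEQ_const_iff)
  with m(1) show False by (simp add: in_keys_iff)
qed

section \<open>The equivalence\<close>

text \<open>Treating \<open>x\<close> as an indeterminate turns equality for all \<open>x\<close>
  into equality of coefficients, and lets the value at \<open>x = 0\<close> be recovered from the
  others.\<close>

definition dichromatic_poly :: "real \<Rightarrow> ('v, 'e) multigraph \<Rightarrow> nat \<Rightarrow> nat \<Rightarrow> real poly" where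
  "dichromatic_poly r G q k =
    (\<Sum>A\<in>Pow (edges G). monom (\<Prod>n\<in>#component_partition G A. \<Sum>i<k. r ^ (n * q ^ i)) (card A))"

lemma poly_dichromatic_poly: "poly (dichromatic_poly r G q k) x = dichromatic r G q x k"
  by (simp add: dichromatic_poly_def dichromatic_def poly_sum poly_monom component_partition_def
      prod_unfold_prod_mset image_mset.compositionality o_def mult.commute)

definition edge_subsets_of_card :: "('v, 'e) multigraph \<Rightarrow> nat \<Rightarrow> 'e set set" where
  "edge_subsets_of_card G a = {A \<in> Pow (edges G). card A = a}"

text \<open>Multiplicities count the edge sets of size \<open>a\<close> with a given partition. Over
  all \<open>a\<close>, and together with the number of vertices, these multisets determine
  \<open>U_polynomial G\<close>.\<close>

definition component_partitions :: "('v, 'e) multigraph \<Rightarrow> nat \<Rightarrow> nat multiset multiset" where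
  "component_partitions G a = image_mset (component_partition G) (mset_set (edge_subsets_of_card G a))"

lemma sum_component_partitions:
  "(\<Sum>\<tau>\<in>#component_partitions G a. f \<tau>) =
    (\<Sum>A\<in>edge_subsets_of_card G a. f (component_partition G A))"
  by (simp add: component_partitions_def sum_unfold_sum_mset image_mset.compositionality o_def)

text \<open>Since \<open>r ^ (n * q ^ i)\<close> is the \<open>n\<close>-th power of
  \<open>r ^ (q ^ i)\<close>, each inner sum is a power sum at these points.\<close>

lemma coeff_dichromatic_poly:
  assumes "is_graph G"
  shows "coeff (dichromatic_poly r G q k) a =
    poly_value (\<lambda>i. r ^ (q ^ i)) (\<Sum>\<tau>\<in>#component_partitions G a. power_sum_product k \<tau>)"
proof -
  have "finite (Pow (edges G))" using assms by (simp add: is_graph_def)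
  then have "coeff (dichromatic_poly r G q k) a = (\<Sum>A\<in>edge_subsets_of_card G a.
    \<Prod>n\<in>#component_partition G A. \<Sum>i<k. r ^ (n * q ^ i))"
    unfolding dichromatic_poly_def edge_subsets_of_card_def
    by (simp only: coeff_sum coeff_monom sum.inter_filter)
  then show ?thesis
    by (simp add: sum_component_partitions poly_value_sum poly_value_power_sum_product
        mult.commute flip: power_mult)
qed

text \<open>At \<open>x = 0\<close> only the empty edge set counts, and at \<open>k = 1\<close>
  every inner sum is \<open>r ^ card C\<close>, whatever \<open>q\<close> is. For
  \<open>r > 1\<close> this value reveals the number of vertices.\<close>

lemma dichromatic_0_1:
  fixes G :: "('v, 'e) multigraph"
  assumes G: "is_graph G"
  shows "dichromatic r G q 0 1 = r ^ card (vertices G)"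
proof -
  have fin: "finite (edges G)" using G by (simp add: is_graph_def)
  have "dichromatic r G q 0 1 = (\<Sum>A\<in>Pow (edges G). 0 ^ card A * r ^ card (vertices G))"
    by (simp add: dichromatic_def sum_card_components[OF G] flip: power_sum)
  also have "\<dots> = (\<Sum>A\<in>{{} :: 'e set}. 0 ^ card A * r ^ card (vertices G))"
    using fin by (intro sum.mono_neutral_right) (auto simp: card_eq_0_iff dest: finite_subset)
  finally show ?thesis by simp
qed

text \<open>The number of components is the number of parts, so a summand depends only on
  \<open>card A\<close>, the partition and the number of vertices. The free bound \<open>N\<close>
  lets two graphs be summed over the same range.\<close>

lemma U_polynomial_conv_component_partitions:
  assumes "is_graph G" "card (edges G) \<le> N"
  shows "U_polynomial G = (\<Sum>a\<le>N. \<Sum>\<tau>\<in>#component_partitions G a.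
    partition_monomial \<tau> * (z_indet - 1) ^ (a + size \<tau> - card (vertices G)))"
proof -
  have fin: "finite (edges G)" using assms by (simp add: is_graph_def)
  let ?F = "\<lambda>A. partition_monomial (component_partition G A) *
    (z_indet - 1) ^ (card A + size (component_partition G A) - card (vertices G))"
  have "(\<Sum>A\<in>Pow (edges G). ?F A) = (\<Sum>a\<le>N. \<Sum>A\<in>{A \<in> Pow (edges G). card A = a}. ?F A)"
    using fin assms(2) by (intro sum.group[symmetric]) (auto intro: card_mono le_trans)
  also have "\<dots> = (\<Sum>a\<le>N. \<Sum>A\<in>edge_subsets_of_card G a. partition_monomial (component_partition G A) *
    (z_indet - 1) ^ (a + size (component_partition G A) - card (vertices G)))"
    by (simp add: edge_subsets_of_card_def)
  finally show ?thesis
    by (simp add: U_polynomial_def sum_component_partitions size_component_partition)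
qed

section \<open>From the dichromatic function to \<open>U\<close>\<close>

lemma dichromatic_determines_U:
  fixes G G' :: "('v, 'e) multigraph"
  assumes r: "r > 1" and G: "is_graph G" and G': "is_graph G'"
    and eq: "dichromatic r G = dichromatic r G'"
  shows "U_polynomial G = U_polynomial G'"
proof -
  have "r ^ card (vertices G) = r ^ card (vertices G')"
    using dichromatic_0_1[OF G, of r 0] dichromatic_0_1[OF G', of r 0] eq by simp
  then have card: "card (vertices G') = card (vertices G)" using r by simp
  \<comment> \<open>A partition of the number of vertices into positive parts has at most this many
    parts, so there are enough variables.\<close>
  define k where "k = card (vertices G)"
  have *: "0 \<notin># \<tau> \<and> size \<tau> \<le> k \<and> sum_mset \<tau> = k"
    if "\<tau> \<in># component_partitions G a + component_partitions G' a" for \<tau> a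
    using that zero_notin_component_partition[OF G] zero_notin_component_partition[OF G']
      card_components_le[OF G] card_components_le[OF G']
      sum_component_partition[OF G] sum_component_partition[OF G'] G G'
    by (auto simp: component_partitions_def size_component_partition k_def card)
  have partitions: "component_partitions G a = component_partitions G' a" for a
  proof (rule sum_power_sum_product_inject)
    let ?S = "\<lambda>G. \<Sum>\<tau>\<in>#component_partitions G a. power_sum_product k \<tau>"
    show "?S G = ?S G'"
    proof (rule poly_value_powers_inject[OF r])
      show "\<forall>m\<in>Poly_Mapping.keys (?S G) \<union> Poly_Mapping.keys (?S G').
        poly (exponent_poly m) 1 = real k"
      proof
        fix m assume "m \<in> Poly_Mapping.keys (?S G) \<union> Poly_Mapping.keys (?S G')"
        then obtain \<tau> where \<tau>: "\<tau> \<in># component_partitions G a + component_partitions G' a"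
          "m \<in> Poly_Mapping.keys (power_sum_product k \<tau>)"
          by (auto simp: keys_sum_mset_nonneg_coeffs nonneg_coeffs_power_sum_product)
        show "poly (exponent_poly m) 1 = real k"
          using exponent_poly_power_sum_product[OF \<tau>(2)] *[OF \<tau>(1)] by (simp only:)
      qed
    next
      fix q
      \<comment> \<open>Agreement at all real \<open>x\<close> makes the polynomials in
        \<open>x\<close> equal, hence also their coefficients at \<open>a\<close>.\<close>
      have "dichromatic_poly r G q k = dichromatic_poly r G' q k"
        unfolding poly_eq_poly_eq_iff[symmetric] by (rule ext) (simp add: poly_dichromatic_poly eq)
      then show "poly_value (\<lambda>i. r ^ (q ^ i)) (?S G) = poly_value (\<lambda>i. r ^ (q ^ i)) (?S G')"
        using coeff_dichromatic_poly[OF G] coeff_dichromatic_poly[OF G'] by metis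
    qed
  qed (use * in blast)
  let ?N = "card (edges G) + card (edges G')"
  show ?thesis
    using U_polynomial_conv_component_partitions[OF G, of ?N]
      U_polynomial_conv_component_partitions[OF G', of ?N]
    by (simp add: partitions card)
qed

section \<open>From \<open>U\<close> to the dichromatic function\<close>

lemma prod_mset_power: "(\<Prod>n\<in>#\<tau>. (t::real) ^ n) = t ^ sum_mset \<tau>"
  by (induction \<tau>) (simp_all add: power_add)

text \<open>At \<open>z = 2\<close> the powers of \<open>z - 1\<close> become \<open>1\<close>, and
  the parts of each partition add up to the number of vertices, so all edge sets contribute
  equally.\<close>

lemma poly_value_U_polynomial_powers:
  assumes G: "is_graph G"
  shows "poly_value (\<lambda>n. if n = 0 then 2 else t ^ n) (U_polynomial G) =
    2 ^ card (edges G) * t ^ card (vertices G)"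
proof -
  have "(\<Prod>n\<in>#component_partition G A. if n = 0 then 2 else t ^ n) = t ^ card (vertices G)" for A
  proof -
    have "(\<Prod>n\<in>#component_partition G A. if n = 0 then 2 else t ^ n) =
      (\<Prod>n\<in>#component_partition G A. t ^ n)"
      using zero_notin_component_partition[OF G, of A]
      by (intro arg_cong[where f = prod_mset] image_mset_cong) (auto intro!: gr0I)
    then show ?thesis by (simp add: prod_mset_power sum_component_partition[OF G])
  qed
  moreover have "finite (edges G)" using G by (simp add: is_graph_def)
  ultimately show ?thesis by (simp add: poly_value_U_polynomial card_Pow)
qed

lemma prod_mset_divide:
  "(\<Prod>n\<in>#\<tau>. f n / (x::real)) = (\<Prod>n\<in>#\<tau>. f n) / x ^ size \<tau>"
  by (induction \<tau>) simp_all

text \<open>With \<open>z - 1 = x\<close>, the division by \<open>x\<close> once per component and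
  the factor \<open>x ^ card (vertices G)\<close> cancel all of the exponent but
  \<open>card A\<close>.\<close>

lemma dichromatic_conv_U_polynomial:
  assumes G: "is_graph G" and x: "x \<noteq> 0"
  shows "dichromatic r G q x k = x ^ card (vertices G) *
    poly_value (\<lambda>n. if n = 0 then x + 1 else (\<Sum>i<k. r ^ (n * q ^ i)) / x) (U_polynomial G)"
proof -
  define f where "f n = (\<Sum>i<k. r ^ (n * q ^ i))" for n
  have fin: "finite (edges G)" using G by (simp add: is_graph_def)
  have "dichromatic r G q x k =
    (\<Sum>A\<in>Pow (edges G). x ^ card A * (\<Prod>n\<in>#component_partition G A. f n))"
    by (simp add: dichromatic_def component_partition_def prod_unfold_prod_mset
      image_mset.compositionality o_def f_def)
  also have "\<dots> = (\<Sum>A\<in>Pow (edges G). x ^ card (vertices G) *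
    ((\<Prod>n\<in>#component_partition G A. if n = 0 then x + 1 else f n / x) *
      x ^ (card A + card (components G A) - card (vertices G))))"
  proof (rule sum.cong)
    fix A assume A: "A \<in> Pow (edges G)"
    then have "finite A" using fin by (auto dest: finite_subset)
    then have le: "card (vertices G) \<le> card A + card (components G A)"
      using card_vertices_le[OF G] A by auto
    have "(\<Prod>n\<in>#component_partition G A. if n = 0 then x + 1 else f n / x) =
      (\<Prod>n\<in>#component_partition G A. f n / x)"
      using zero_notin_component_partition[OF G, of A]
      by (intro arg_cong[where f = prod_mset] image_mset_cong) auto
    also have "\<dots> = (\<Prod>n\<in>#component_partition G A. f n) / x ^ card (components G A)"
      by (simp add: prod_mset_divide size_component_partition)
    finally have *: "(\<Prod>n\<in>#component_partition G A. if n = 0 then x + 1 else f n / x) = \<dots>" .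
    \<comment> \<open>Here \<open>le\<close> makes the subtraction of natural numbers exact.\<close>
    have "x ^ card (vertices G) * x ^ (card A + card (components G A) - card (vertices G)) =
      x ^ card A * x ^ card (components G A)"
      using le by (simp flip: power_add)
    then show "x ^ card A * (\<Prod>n\<in>#component_partition G A. f n) = x ^ card (vertices G) *
      ((\<Prod>n\<in>#component_partition G A. if n = 0 then x + 1 else f n / x) *
      x ^ (card A + card (components G A) - card (vertices G)))"
      unfolding * using x by (simp add: field_simps)
  qed simp
  finally show ?thesis
    unfolding f_def by (simp add: poly_value_U_polynomial sum_distrib_left)
qed

lemma U_determines_dichromatic:
  fixes G G' :: "('v, 'e) multigraph"
  assumes G: "is_graph G" and G': "is_graph G'" and eq: "U_polynomial G = U_polynomial G'"
  shows "dichromatic r G = dichromatic r G'"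
proof -
  have val: "2 ^ card (edges G) * t ^ card (vertices G) =
    2 ^ card (edges G') * t ^ card (vertices G')" for t :: real
    using poly_value_U_polynomial_powers[OF G] poly_value_U_polynomial_powers[OF G'] eq by metis
  \<comment> \<open>The value at \<open>t = 1\<close> compares the numbers of edges; the value at
    \<open>t = 2\<close> then compares the numbers of vertices.\<close>
  have card: "card (vertices G) = card (vertices G')"
    using val[of 1] val[of 2] by simp
  have "dichromatic r G q x k = dichromatic r G' q x k" for q x k
  proof -
    let ?p = "dichromatic_poly r G q k" and ?p' = "dichromatic_poly r G' q k"
    \<comment> \<open>The substitution into \<open>U\<close> excludes \<open>x = 0\<close>. The
      extra factor makes both sides vanish there and is cancelled afterwards.\<close>
    have "poly ([:0, 1:] * ?p) x = poly ([:0, 1:] * ?p') x" for x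
      by (cases "x = 0")
         (simp_all add: poly_dichromatic_poly dichromatic_conv_U_polynomial[OF G]
           dichromatic_conv_U_polynomial[OF G'] eq card)
    then have "[:0, 1:] * ?p = [:0, 1:] * ?p'"
      unfolding poly_eq_poly_eq_iff[symmetric] by (rule ext)
    then have "?p = ?p'" by simp
    then show ?thesis by (metis poly_dichromatic_poly)
  qed
  then show ?thesis by (intro ext)
qed

theorem corollary2:
  fixes r :: real
  assumes "r > 1"
  shows "equivalent (dichromatic r :: ('v, 'e) multigraph \<Rightarrow> nat \<Rightarrow> real \<Rightarrow> nat \<Rightarrow> real)
           (U_polynomial :: ('v, 'e) multigraph \<Rightarrow> polynomial)"
  unfolding equivalent_def determines_def
  using dichromatic_determines_U[OF assms] U_determines_dichromatic by blast

end
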